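(* Let $a$ be a positive integer. Then the following are true. (i) As formal power series, $$q^{-a}\cdot \mathcal{U}^{\star}_a(q)= \sum_{n=0}^{a}p_n(a)q^n+ O(q^{a+1}).$$ (ii) If $n\leq 2a$, then $M(a;n)=p_{n-a}(a)$.
   Context: For a positive integer $a$, the formal power series $\mathcal{U}_a^{\star}(q)$ and its coefficients $M(a;n)$ are defined by $$\mathcal{U}_a^{\star}(q)=\sum_{n\geq0}M(a;n)\,q^n:=\sum_{1\leq k_1\leq k_2\leq\cdots\leq k_a} \frac{q^{k_1+k_2+\cdots+k_a}}{(1-q^{k_1})^2(1-q^{k_2})^2\cdots(1-q^{k_a})^2}.$$ The polynomials $p_n(x)$ are defined by $p_0(x):=1$ and, for $n\geq1$, $$p_n(x):=\binom{2x+n-1}{n}+\binom{2x+n-2}{n-1}.$$ For $n<0$, $p_n(x):=0$. $O(q^{a+1})$ denotes a formal power series in $q$ all of whose terms have exponent at least $a+1$. *)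

theory Defs
  imports "HOL-Analysis.Analysis" "HOL-Computational_Algebra.Computational_Algebra"
begin

text \<open>
  The coefficient ring is \<^typ>\<open>rat\<close>, since division of formal power series needs a field.
\<close>

text \<open>The tuples \<open>1 \<le> k\<^sub>1 \<le> \<dots> \<le> k\<^sub>a\<close>, as lists.\<close>

definition tuples :: "nat \<Rightarrow> nat list set" where
  "tuples a = {ks. length ks = a \<and> sorted ks \<and> (\<forall>k\<in>set ks. 1 \<le> k)}"

definition U_term :: "nat list \<Rightarrow> rat fps" where
  "U_term ks = fps_X ^ sum_list ks / (\<Prod>k\<leftarrow>ks. (1 - fps_X ^ k)\<^sup>2)"

text \<open>
  The infinite sum is taken in the \<open>X\<close>-adic topology on \<^typ>\<open>rat fps\<close>.
  It converges by lemma \<open>summable_U_term\<close> below.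
\<close>

definition U_star :: "nat \<Rightarrow> rat fps" where
  "U_star a = (\<Sum>\<^sub>\<infinity>ks\<in>tuples a. U_term ks)"

definition M :: "nat \<Rightarrow> nat \<Rightarrow> rat" where
  "M a n = fps_nth (U_star a) n"

text \<open>
  The binomial coefficient of a polynomial: the library's \<open>gchoose\<close> is only accepted on fields of
  characteristic 0, so it only gives the values (lemma \<open>poly_binom_poly\<close> below).
\<close>

definition binom_poly :: "rat poly \<Rightarrow> nat \<Rightarrow> rat poly" where
  "binom_poly f k = smult (1 / fact k) (\<Prod>i=0..<k. f - of_nat i)"

text \<open>Here \<open>[:c, 2:]\<close> is the polynomial \<open>2x + c\<close>.\<close>

definition p_poly :: "int \<Rightarrow> rat poly" where
  "p_poly n =
     (if n < 0 then 0
      else if n = 0 then 1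
      else binom_poly [:of_int n - 1, 2:] (nat n) + binom_poly [:of_int n - 2, 2:] (nat (n - 1)))"

definition bigO_fps :: "nat \<Rightarrow> rat fps set" where
  "bigO_fps N = {R. \<forall>n. fps_nth R n \<noteq> 0 \<longrightarrow> N \<le> n}"

lemma fps_nth_U_term_eq_0:
  assumes "ks \<in> tuples a" "n < sum_list ks"
  shows "fps_nth (U_term ks) n = 0"
proof -
  have "fps_nth (\<Prod>k\<leftarrow>ks. (1 - fps_X ^ k)\<^sup>2 :: rat fps) 0 \<noteq> 0"
    if "\<forall>k\<in>set ks. 1 \<le> k" for ks :: "nat list"
    using that by (induction ks) (auto simp: power2_eq_square fps_X_power_nth)
  then have "U_term ks = fps_X ^ sum_list ks * inverse (\<Prod>k\<leftarrow>ks. (1 - fps_X ^ k)\<^sup>2)"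
    using assms(1) unfolding U_term_def tuples_def by (intro fps_divide_unit) auto
  then show ?thesis
    using assms(2) by (simp add: fps_X_power_mult_nth)
qed

lemma summable_U_term: "U_term summable_on tuples a"
proof -
  have "finite {ks \<in> tuples a. fps_nth (U_term ks) n \<noteq> 0}" for n
  proof (rule finite_subset)
    show "{ks \<in> tuples a. fps_nth (U_term ks) n \<noteq> 0} \<subseteq> {ks. set ks \<subseteq> {..n} \<and> length ks = a}"
    proof safe
      fix ks k assume "ks \<in> tuples a" "fps_nth (U_term ks) n \<noteq> 0" "k \<in> set ks"
      then have "sum_list ks \<le> n" "k \<le> sum_list ks"
        using fps_nth_U_term_eq_0[of ks a n] by (auto simp: member_le_sum_list not_le[symmetric])
      then show "k \<le> n" by simp
    qed (auto simp: tuples_def)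
  qed (rule finite_lists_length_eq, simp)
  then have "(U_term has_sum Abs_fps (\<lambda>n. \<Sum>ks | ks \<in> tuples a \<and> fps_nth (U_term ks) n \<noteq> 0.
               fps_nth (U_term ks) n)) (tuples a)"
    by (intro has_sum_fpsI) auto
  then show ?thesis
    by (auto simp: summable_on_def)
qed

lemma poly_binom_poly: "poly (binom_poly f k) x = poly f x gchoose k"
  by (simp add: binom_poly_def gbinomial_prod_rev poly_prod)

lemma poly_p_poly:
  "poly (p_poly (int n)) x =
     (if n = 0 then 1
      else ((2 * x + of_nat n - 1) gchoose n) + ((2 * x + of_nat n - 2) gchoose (n - 1)))"
  by (auto simp: p_poly_def poly_binom_poly algebra_simps nat_diff_distrib)

end

theory Submission
  imports Defs
begin

text \<open>
  Put \<open>x\<^sub>k = q\<^sup>k / (1 - q\<^sup>k)\<^sup>2\<close>, so that \<open>U_star a\<close> is the complete homogeneous symmetric function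
  \<open>h\<^sub>a(x\<^sub>1, x\<^sub>2, \<dots>)\<close>. Since
  \<open>(1 - q\<^sup>k)\<^sup>2 - q\<^bsup>k-1\<^esup> (1 - q)\<^sup>2 = (1 - q\<^bsup>k-1\<^esup>) (1 - q\<^bsup>k+1\<^esup>)\<close>, the product of the \<open>1 / (1 - x\<^sub>k / x\<^sub>1)\<close>
  over \<open>2 \<le> k \<le> N\<close> telescopes to \<open>P\<^sub>N = (1 + q) (1 - q\<^sup>N) / (1 - q\<^bsup>N+1\<^esup>)\<close>, which tends to \<open>1 + q\<close>.
  Because \<open>x\<^sub>k\<close> has order at least 2 for \<open>k \<ge> 2\<close>, the recursion
  \<open>h\<^sub>a(x\<^sub>1, \<dots>, x\<^sub>N) = h\<^sub>a(x\<^sub>1, \<dots>, x\<^bsub>N-1\<^esub>) + x\<^sub>N h\<^bsub>a-1\<^esub>(x\<^sub>1, \<dots>, x\<^sub>N)\<close> shows by induction that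
  \<open>h\<^sub>a(x\<^sub>1, \<dots>, x\<^sub>N)\<close> agrees with \<open>x\<^sub>1\<^sup>a P\<^sub>N\<close> modulo \<open>q\<^bsup>2a+1\<^esup>\<close>. Hence \<open>U_star a\<close> agrees with
  \<open>q\<^sup>a (1 + q) / (1 - q)\<^bsup>2a\<^esup>\<close> modulo \<open>q\<^bsup>2a+1\<^esup>\<close>.
\<close>

section \<open>Terms as products over the entries\<close>

lemma fps_X_power_dvd_imp_nth_eq_0:
  fixes f :: "'a :: comm_semiring_1 fps"
  assumes "fps_X ^ m dvd f" "n < m"
  shows "fps_nth f n = 0"
  using assms by (auto simp: dvd_def fps_X_power_mult_nth)

definition part_factor :: "nat \<Rightarrow> rat fps" where
  "part_factor k = fps_X ^ k * inverse ((1 - fps_X ^ k)\<^sup>2)"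

lemma fps_nth_one_minus_fps_X_power_0:
  assumes "k > 0"
  shows "fps_nth (1 - fps_X ^ k :: 'a :: comm_ring_1 fps) 0 = 1"
  using assms by (simp add: fps_X_power_nth)

lemma U_term_eq_prod_list:
  assumes "\<forall>k\<in>set ks. 1 \<le> k"
  shows "U_term ks = (\<Prod>k\<leftarrow>ks. part_factor k)"
proof -
  have nz: "fps_nth (\<Prod>k\<leftarrow>ks. (1 - fps_X ^ k)\<^sup>2 :: rat fps) 0 \<noteq> 0"
    using assms by (induction ks) (auto simp: power2_eq_square fps_X_power_nth)
  have "U_term ks = fps_X ^ sum_list ks * inverse (\<Prod>k\<leftarrow>ks. (1 - fps_X ^ k)\<^sup>2)"
    unfolding U_term_def using nz by (rule fps_divide_unit)
  also have "\<dots> = (\<Prod>k\<leftarrow>ks. part_factor k)"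
    by (induction ks) (auto simp: part_factor_def fps_inverse_mult power_add)
  finally show ?thesis .
qed

section \<open>Truncation to finitely many variables\<close>

definition bounded_tuples :: "nat \<Rightarrow> nat \<Rightarrow> nat list set" where
  "bounded_tuples N a = {ks \<in> tuples a. set ks \<subseteq> {..N}}"

definition bounded_U :: "nat \<Rightarrow> nat \<Rightarrow> rat fps" where
  "bounded_U N a = (\<Sum>ks\<in>bounded_tuples N a. U_term ks)"

lemma finite_bounded_tuples [simp]: "finite (bounded_tuples N a)"
  by (rule finite_subset[OF _ finite_lists_length_eq[of "{..N}" a]])
     (auto simp: bounded_tuples_def tuples_def)

text \<open>In a sorted tuple the last entry is the largest, so it decides whether
  \<open>Suc N\<close> occurs. Repetitions are allowed, so removing it leaves the bound
  \<open>Suc N\<close>.\<close>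

lemma bounded_tuples_Suc_Suc:
  "bounded_tuples (Suc N) (Suc a) =
     bounded_tuples N (Suc a) \<union> (\<lambda>ks. ks @ [Suc N]) ` bounded_tuples (Suc N) a"
proof (intro equalityI subsetI)
  fix ks assume ks: "ks \<in> bounded_tuples (Suc N) (Suc a)"
  then have len: "length ks = Suc a"
    by (simp add: bounded_tuples_def tuples_def)
  then obtain js j where js: "ks = js @ [j]"
    by (cases ks rule: rev_cases) auto
  show "ks \<in> bounded_tuples N (Suc a) \<union> (\<lambda>ks. ks @ [Suc N]) ` bounded_tuples (Suc N) a"
  proof (cases "j = Suc N")
    case True
    then show ?thesis
      using ks js by (auto simp: bounded_tuples_def tuples_def sorted_append)
  next
    case False
    then have "j \<le> N"
      using ks js by (auto simp: bounded_tuples_def)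
    then have "set ks \<subseteq> {..N}"
      using ks js by (fastforce simp: bounded_tuples_def tuples_def sorted_append)
    then show ?thesis
      using ks by (auto simp: bounded_tuples_def)
  qed
next
  fix ks assume "ks \<in> bounded_tuples N (Suc a) \<union> (\<lambda>ks. ks @ [Suc N]) ` bounded_tuples (Suc N) a"
  then show "ks \<in> bounded_tuples (Suc N) (Suc a)"
    by (fastforce simp: bounded_tuples_def tuples_def sorted_append)
qed

lemma bounded_U_0_right: "bounded_U N 0 = 1"
proof -
  have "bounded_tuples N 0 = {[]}"
    by (auto simp: bounded_tuples_def tuples_def)
  then show ?thesis
    by (simp add: bounded_U_def U_term_eq_prod_list)
qed

lemma bounded_U_0_Suc: "bounded_U 0 (Suc a) = 0"
proof -
  have "bounded_tuples 0 (Suc a) = {}"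
    by (force simp: bounded_tuples_def tuples_def length_Suc_conv)
  then show ?thesis
    by (simp add: bounded_U_def)
qed

lemma bounded_U_Suc_Suc:
  "bounded_U (Suc N) (Suc a) = bounded_U N (Suc a) + part_factor (Suc N) * bounded_U (Suc N) a"
proof -
  have disj: "bounded_tuples N (Suc a) \<inter> (\<lambda>ks. ks @ [Suc N]) ` bounded_tuples (Suc N) a = {}"
    by (auto simp: bounded_tuples_def)
  have inj: "inj_on (\<lambda>ks. ks @ [Suc N]) (bounded_tuples (Suc N) a)"
    by (auto intro: inj_onI)
  have "U_term (ks @ [Suc N]) = part_factor (Suc N) * U_term ks"
    if "ks \<in> bounded_tuples (Suc N) a" for ks
    using that by (simp add: U_term_eq_prod_list bounded_tuples_def tuples_def)
  then show ?thesis
    by (simp add: bounded_U_def bounded_tuples_Suc_Suc sum.union_disjoint disj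
          sum.reindex[OF inj] sum_distrib_left)
qed

section \<open>The telescoping product\<close>

definition telescoped :: "nat \<Rightarrow> rat fps" where
  "telescoped N = (1 + fps_X) * (1 - fps_X ^ N) * inverse (1 - fps_X ^ Suc N)"

lemma telescoped_Suc_0: "telescoped (Suc 0) = 1"
proof -
  have "(1 + fps_X) * (1 - fps_X ^ Suc 0) = (1 - fps_X ^ Suc (Suc 0) :: rat fps)"
    by (simp add: algebra_simps)
  then show ?thesis
    unfolding telescoped_def by (simp only: inverse_mult_eq_1' fps_nth_one_minus_fps_X_power_0)
qed

text \<open>Treating inverses as variables \<open>a\<close>, \<open>b\<close>, \<open>c\<close>
  turns the telescoping step into a polynomial ideal membership.\<close>

lemma telescope_identity:
  fixes A B C D x y z a b c :: "'a :: idom"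
  assumes "A * a = 1" "B * b = 1" "C * c = 1" "D * C + y * A\<^sup>2 = B\<^sup>2"
  shows "x * a\<^sup>2 * z * D * b + x * y * b\<^sup>2 * z * B * c = x * a\<^sup>2 * z * B * c"
  using assms by algebra

text \<open>This is P_(N+1) (1 - x_(N+1) / x_1) = P_N with the denominator x_1 cleared.\<close>

lemma telescoped_step:
  "part_factor 1 * telescoped N + part_factor (Suc N) * telescoped (Suc N) =
     part_factor 1 * telescoped (Suc N)"
proof -
  define A B C D where "A = (1 - fps_X :: rat fps)" and "B = (1 - fps_X ^ Suc N :: rat fps)"
    and "C = (1 - fps_X ^ Suc (Suc N) :: rat fps)" and "D = (1 - fps_X ^ N :: rat fps)"
  have nz: "fps_nth A 0 \<noteq> 0" "fps_nth B 0 \<noteq> 0" "fps_nth C 0 \<noteq> 0"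
    by (simp_all add: A_def B_def C_def fps_nth_one_minus_fps_X_power_0)
  have inv: "A * inverse A = 1" "B * inverse B = 1" "C * inverse C = 1"
    using nz by (simp_all add: inverse_mult_eq_1')
  have key: "D * C + fps_X ^ N * A\<^sup>2 = B\<^sup>2"
    by (simp add: A_def B_def C_def D_def power2_eq_square algebra_simps)
  have "fps_X * (inverse A)\<^sup>2 * (1 + fps_X) * D * inverse B +
          fps_X * fps_X ^ N * (inverse B)\<^sup>2 * (1 + fps_X) * B * inverse C =
        fps_X * (inverse A)\<^sup>2 * (1 + fps_X) * B * inverse C"
    by (rule telescope_identity[OF inv key])
  then show ?thesis
    by (simp add: part_factor_def telescoped_def A_def B_def C_def D_def fps_inverse_power mult_ac)
qed

lemma fps_X_power_dvd_part_factor: "fps_X ^ k dvd part_factor k"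
  by (simp add: part_factor_def)

lemma fps_X_dvd_telescoped_minus_1:
  assumes "N > 0"
  shows "fps_X dvd telescoped N - 1"
proof -
  have "fps_X dvd f" if "fps_nth f 0 = 0" for f :: "rat fps"
  proof
    show "f = fps_X * fps_shift 1 f"
      using that by (simp add: fps_eq_iff)
  qed
  moreover have "fps_nth (telescoped N - 1) 0 = 0"
    using assms by (simp add: telescoped_def fps_nth_one_minus_fps_X_power_0)
  ultimately show ?thesis .
qed

section \<open>The congruence modulo q^(2a+1)\<close>

text \<open>Splits the new error into the error with one variable fewer and \<open>y\<close> times
  the error in one degree less.\<close>

lemma congruence_step_identity:
  fixes x y P Q H G u :: "'a :: comm_ring_1"
  assumes "x * Q + y * P = x * P"
  shows "H + y * G - x * u * P = H - x * u * Q + y * (G - u * P)"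
proof -
  have "x * u * P = u * (x * Q + y * P)"
    using assms by (simp add: mult_ac)
  then show ?thesis
    by (simp add: algebra_simps)
qed

lemma bounded_U_cong:
  "fps_X ^ (2 * a + 1) dvd bounded_U (Suc N) a - part_factor 1 ^ a * telescoped (Suc N)"
proof (induction N arbitrary: a)
  case 0
  have "bounded_U (Suc 0) a = part_factor 1 ^ a"
    by (induction a) (simp_all add: bounded_U_0_right bounded_U_Suc_Suc bounded_U_0_Suc)
  then show ?case
    by (simp add: telescoped_Suc_0)
next
  case (Suc N)
  \<comment> \<open>The recursion lowers either the number of variables or the degree, hence the
    nested induction on \<open>a\<close>; this outer hypothesis is needed at degree a + 1.\<close>
  note IH = Suc.IH
  show ?case
  proof (induction a)
    case 0
    show ?case
      using fps_X_dvd_telescoped_minus_1[of "Suc (Suc N)"]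
      by (simp add: bounded_U_0_right dvd_diff_commute)
  next
    case (Suc a)
    let ?x = "part_factor (Suc (Suc N))" and ?P = "telescoped (Suc (Suc N))"
    \<comment> \<open>The index is at least 2, which supplies the two extra powers separating 2a + 1
      from 2(a + 1) + 1.\<close>
    have "fps_X ^ 2 dvd (fps_X ^ Suc (Suc N) :: rat fps)"
      by (rule le_imp_power_dvd) simp
    then have "fps_X ^ 2 dvd ?x"
      using fps_X_power_dvd_part_factor dvd_trans by blast
    then have "fps_X ^ 2 * fps_X ^ (2 * a + 1) dvd
        ?x * (bounded_U (Suc (Suc N)) a - part_factor 1 ^ a * ?P)"
      using Suc.IH by (rule mult_dvd_mono)
    then have "fps_X ^ (2 * Suc a + 1) dvd
        ?x * (bounded_U (Suc (Suc N)) a - part_factor 1 ^ a * ?P)"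
      by (simp add: power2_eq_square mult_ac)
    moreover have "bounded_U (Suc (Suc N)) (Suc a) - part_factor 1 ^ Suc a * ?P =
        (bounded_U (Suc N) (Suc a) - part_factor 1 ^ Suc a * telescoped (Suc N)) +
        ?x * (bounded_U (Suc (Suc N)) a - part_factor 1 ^ a * ?P)"
      unfolding bounded_U_Suc_Suc[of "Suc N" a] power_Suc
      by (rule congruence_step_identity[OF telescoped_step])
    ultimately show ?case
      using IH[of "Suc a"] by (metis dvd_add)
  qed
qed

text \<open>The numerator 1 - q^N and the denominator 1 - q^(N+1) differ by a multiple of
  q^N.\<close>

lemma telescoped_cong: "fps_X ^ N dvd telescoped N - (1 + fps_X)"
proof -
  define i :: "rat fps" where "i = inverse (1 - fps_X ^ Suc N)"
  have "1 + fps_X = (1 + fps_X) * ((1 - fps_X ^ Suc N) * i)"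
    unfolding i_def by (subst inverse_mult_eq_1') (simp_all add: fps_nth_one_minus_fps_X_power_0)
  then have "telescoped N - (1 + fps_X) =
      (1 + fps_X) * (1 - fps_X ^ N) * i - (1 + fps_X) * ((1 - fps_X ^ Suc N) * i)"
    by (simp only: telescoped_def i_def)
  also have "\<dots> = fps_X ^ N * ((1 + fps_X) * (fps_X - 1) * i)"
    by (simp add: algebra_simps)
  finally show ?thesis
    by simp
qed

text \<open>A tuple with an entry above \<open>N\<close> has sum above \<open>n\<close>, so its term
  does not reach q^n.\<close>

lemma M_eq_nth_bounded_U:
  assumes "n \<le> N"
  shows "M a n = fps_nth (bounded_U N a) n"
proof -
  have "(U_term has_sum U_star a) (tuples a)"
    unfolding U_star_def by (rule has_sum_infsum[OF summable_U_term])
  then have "M a n = (\<Sum>ks | ks \<in> tuples a \<and> fps_nth (U_term ks) n \<noteq> 0. fps_nth (U_term ks) n)"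
    unfolding M_def by (rule has_sum_fpsD)
  also have "\<dots> = (\<Sum>ks\<in>bounded_tuples N a. fps_nth (U_term ks) n)"
  proof (rule sum.mono_neutral_left)
    show "{ks \<in> tuples a. fps_nth (U_term ks) n \<noteq> 0} \<subseteq> bounded_tuples N a"
    proof
      fix ks assume ks: "ks \<in> {ks \<in> tuples a. fps_nth (U_term ks) n \<noteq> 0}"
      then have "sum_list ks \<le> n"
        using fps_nth_U_term_eq_0[of ks a n] by (auto simp: not_le[symmetric])
      then have "k \<le> N" if "k \<in> set ks" for k
        using member_le_sum_list[OF that] assms by linarith
      then show "ks \<in> bounded_tuples N a"
        using ks by (auto simp: bounded_tuples_def)
    qed
  qed (simp, auto simp: bounded_tuples_def)
  finally show ?thesis
    by (simp add: bounded_U_def fps_sum_nth)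
qed

section \<open>Coefficients of the main term\<close>

lemma fps_nth_main_term:
  assumes "a > 0"
  shows "fps_nth ((1 + fps_X) * inverse ((1 - fps_X) ^ (2 * a))) n =
           poly (p_poly (int n)) (of_nat a)"
proof -
  \<comment> \<open>Negative binomial series; positivity of \<open>a\<close> makes the truncated
    subtraction in 2a + m - 1 agree with the rational one.\<close>
  have nth: "fps_nth (inverse ((1 - fps_X) ^ (2 * a))) m = ((2 * of_nat a + of_nat m - 1) gchoose m :: rat)" for m
    using assms one_minus_const_fps_X_neg_power'[of "2 * a" "1 :: rat"]
    by (simp add: binomial_gbinomial of_nat_diff)
  show ?thesis
  proof (cases n)
    case (Suc m)
    have "fps_nth ((1 + fps_X) * inverse ((1 - fps_X) ^ (2 * a))) n =
        ((2 * of_nat a + of_nat n - 1) gchoose n) + ((2 * of_nat a + of_nat m - 1) gchoose m :: rat)"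
      by (simp add: distrib_right nth Suc del: of_nat_Suc)
    also have "\<dots> = poly (p_poly (int n)) (of_nat a)"
      unfolding poly_p_poly using Suc by (simp add: algebra_simps)
    finally show ?thesis .
  qed (simp add: p_poly_def fps_power_zeroth)
qed

lemma M_eq_p_poly:
  assumes "a > 0" "n \<le> 2 * a"
  shows "M a n = poly (p_poly (int n - int a)) (of_nat a)"
proof -
  \<comment> \<open>The least \<open>N\<close> for which \<open>telescoped_cong\<close> reaches the
    precision q^(2a+1).\<close>
  define N where "N = 2 * a + 1"
  have "fps_X ^ (2 * a + 1) dvd bounded_U N a - part_factor 1 ^ a * telescoped N"
    using bounded_U_cong[of a "2 * a"] by (simp add: N_def)
  moreover have "fps_X ^ (2 * a + 1) dvd part_factor 1 ^ a * (telescoped N - (1 + fps_X))"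
    using telescoped_cong[of N] by (auto simp: N_def intro: dvd_mult)
  ultimately have "fps_X ^ (2 * a + 1) dvd
      (bounded_U N a - part_factor 1 ^ a * telescoped N) +
      part_factor 1 ^ a * (telescoped N - (1 + fps_X))"
    by (rule dvd_add)
  then have "fps_X ^ (2 * a + 1) dvd bounded_U N a - part_factor 1 ^ a * (1 + fps_X)"
    by (simp add: algebra_simps)
  then have "fps_nth (bounded_U N a - part_factor 1 ^ a * (1 + fps_X)) n = 0"
    by (rule fps_X_power_dvd_imp_nth_eq_0) (use assms in simp)
  then have "M a n = fps_nth (part_factor 1 ^ a * (1 + fps_X)) n"
    using M_eq_nth_bounded_U[of n N a] assms by (simp add: N_def)
  also have "part_factor 1 ^ a * (1 + fps_X) =
      fps_X ^ a * ((1 + fps_X) * inverse ((1 - fps_X) ^ (2 * a)))"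
    by (simp add: part_factor_def power_mult_distrib fps_inverse_power mult_ac flip: power_mult)
  also have "fps_nth \<dots> n = poly (p_poly (int n - int a)) (of_nat a)"
  proof (cases "n < a")
    case True
    then show ?thesis
      by (simp add: fps_X_power_mult_nth p_poly_def)
  next
    case False
    then show ?thesis
      using fps_nth_main_term[OF assms(1), of "n - a"]
      by (simp add: fps_X_power_mult_nth of_nat_diff)
  qed
  finally show ?thesis .
qed

theorem theorem1p2:
  fixes a :: nat
  assumes "a > 0"
  shows "(\<exists>R\<in>bigO_fps (a + 1).
            fls_X powi (- int a) * fps_to_fls (U_star a) =
            fps_to_fls ((\<Sum>n=0..a. fps_const (poly (p_poly (int n)) (of_nat a)) * fps_X ^ n) + R))
       \<and> (\<forall>n::nat. n \<le> 2 * a \<longrightarrow> M a n = poly (p_poly (int n - int a)) (of_nat a))"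
proof
  let ?S = "\<Sum>n=0..a. fps_const (poly (p_poly (int n)) (of_nat a)) * fps_X ^ n :: rat fps"
  define V where "V = fps_shift a (U_star a)"
  \<comment> \<open>Here p has a negative index and vanishes, so the shift by \<open>a\<close> loses
    no coefficient.\<close>
  have "fps_nth (U_star a) n = 0" if "n < a" for n
    using M_eq_p_poly[OF assms, of n] that by (simp add: M_def p_poly_def)
  then have "U_star a = fps_X ^ a * V"
    by (auto simp: fps_eq_iff V_def fps_X_power_mult_nth)
  then have "fls_X powi (- int a) * fps_to_fls (U_star a) = fps_to_fls V"
    by (simp add: fls_times_fps_to_fls fps_to_fls_power power_int_minus)
  moreover have "V - ?S \<in> bigO_fps (a + 1)"
  proof -
    have "fps_nth V n = fps_nth ?S n" if "n \<le> a" for n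
    proof -
      have "fps_nth V n = M a (n + a)"
        by (simp add: V_def M_def)
      also have "\<dots> = poly (p_poly (int n)) (of_nat a)"
        using M_eq_p_poly[OF assms, of "n + a"] that by simp
      also have "\<dots> = fps_nth ?S n"
        using that by (simp add: fps_sum_nth fps_X_power_nth if_distrib sum.delta cong: if_cong)
      finally show ?thesis .
    qed
    then show ?thesis
      by (force simp: bigO_fps_def not_less_eq_eq)
  qed
  ultimately show "\<exists>R\<in>bigO_fps (a + 1).
      fls_X powi (- int a) * fps_to_fls (U_star a) = fps_to_fls (?S + R)"
    by (intro bexI[of _ "V - ?S"]) simp_all
  show "\<forall>n::nat. n \<le> 2 * a \<longrightarrow> M a n = poly (p_poly (int n - int a)) (of_nat a)"
    using M_eq_p_poly[OF assms] by blast
qed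

end
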